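(* Let $\alpha>0$, $s>0$ and let $n\ge1$ be an integer. If $H_m:=s\frac{d}{ds}\ln D_m(s)$ for $m\ge0$, and $\delta^2H_n:=H_{n-1}-H_{n+1}$, then $$\{[H_n-n(n+\alpha)]\,\delta^2H_n+ns\}\,\{[H_n-n(n+\alpha)-s]\,\delta^2H_n-(n+\alpha)s\}$$ $$=(2n+\alpha+\delta^2H_n)\,\{ns+(2n+\alpha)[n(n+\alpha)-H_n]\}\,(H_n-H_{n+1})(H_{n-1}-H_n).$$
   Context: For $\alpha>0$ and $s>0$, $D_n(s)$ is the Hankel determinant $$D_n(s)=\det\left(\int_0^\infty x^{j+k}\,x^{\alpha}e^{-x-s/x}\,dx\right)_{j,k=0}^{n-1},\qquad D_0=1$$ (so $H_0=0$). *)

theory Defs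
  imports "HOL-Analysis.Analysis" "Jordan_Normal_Form.Determinant"
begin

(* The qualified names matter: the determinant and matrices of HOL-Analysis have their
   dimension fixed by a type, whereas here the size n is a term. *)
definition hankel_D :: "real \<Rightarrow> nat \<Rightarrow> real \<Rightarrow> real" where
  "hankel_D \<alpha> n s = Determinant.det (Matrix.mat n n (\<lambda>(j, k).
     LBINT x:{0<..}. x ^ (j + k) * x powr \<alpha> * exp (- x - s / x)))"

definition hankel_H :: "real \<Rightarrow> nat \<Rightarrow> real \<Rightarrow> real" where
  "hankel_H \<alpha> m s = s * deriv (\<lambda>t. ln (hankel_D \<alpha> m t)) s"

definition delta2_H :: "real \<Rightarrow> nat \<Rightarrow> real \<Rightarrow> real" where
  "delta2_H \<alpha> n s = hankel_H \<alpha> (n - 1) s - hankel_H \<alpha> (n + 1) s"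

end

theory Submission
  imports Defs
begin

hide_const (open) Module.smult

text \<open>
  Let \<open>P\<^sub>n\<close> be the monic orthogonal polynomials of the weight \<open>w(x) = x\<^sup>\<alpha> e\<^bsup>-x-s/x\<^esup>\<close> on the positive half-line,
  \<open>L\<close> integration against \<open>w\<close>, \<open>h\<^sub>n = L(P\<^sub>n\<^sup>2)\<close>, \<open>\<beta> = h\<^sub>n / h\<^sub>n\<^sub>-\<^sub>1\<close>,
  \<open>a\<^sub>n = s L(P\<^sub>n\<^sup>2/x) / h\<^sub>n\<close> and \<open>b = s L(P\<^sub>n P\<^sub>n\<^sub>-\<^sub>1/x) / h\<^sub>n\<^sub>-\<^sub>1\<close>.
  In the basis \<open>P\<^sub>j\<close> the Hankel matrix is diagonal at the given \<open>s\<close>, so \<open>D\<^sub>n = \<Prod>\<^bsub>j<n\<^esub> h\<^sub>j\<close>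
  and, since \<open>d/ds w = - w/x\<close>, \<open>H\<^sub>n = - \<Sum>\<^bsub>j<n\<^esub> a\<^sub>j\<close>; in particular \<open>\<delta>\<^sup>2H\<^sub>n = a\<^sub>n + a\<^sub>n\<^sub>-\<^sub>1\<close>.
  Orthogonality and integration by parts, \<open>L(f') = L((1 - \<alpha>/x - s/x\<^sup>2) f)\<close>, give
  \<open>\<beta> = n(n + \<alpha>) + b - H\<^sub>n\<close>, \<open>ns - (2n + \<alpha>) b = \<beta> (a\<^sub>n + a\<^sub>n\<^sub>-\<^sub>1)\<close> and
  \<open>b\<^sup>2 - s b = \<beta> a\<^sub>n a\<^sub>n\<^sub>-\<^sub>1\<close>. With \<open>K = 2n + \<alpha> + \<delta>\<^sup>2H\<^sub>n\<close> the first two say that the three braces of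
  the claim are \<open>b K\<close>, \<open>(b - s) K\<close> and \<open>\<beta> K\<close>, and the third finishes the proof.
\<close>

section \<open>Orthogonal polynomials of a semiclassical functional\<close>

text \<open>The hypotheses are the integration by parts identities for \<open>P\<^sub>n\<^sup>2\<close>, \<open>P\<^sub>n P\<^sub>n\<^sub>-\<^sub>1\<close> and \<open>P\<^sub>n\<^sub>-\<^sub>1\<^sup>2\<close>, the middle one
  expanded in two ways, with \<open>p0 + p1 x\<close> and \<open>q0 + q1 x\<close> the lowest terms of \<open>P\<^sub>n\<close> and \<open>P\<^sub>n\<^sub>-\<^sub>1\<close>,
  \<open>c = L(P\<^sub>n/x)\<close>, \<open>d = L(P\<^sub>n/x\<^sup>2)\<close>, and \<open>c'\<close>, \<open>d'\<close> the same for \<open>P\<^sub>n\<^sub>-\<^sub>1\<close>.\<close>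
lemma b_linear_elimination:
  fixes s :: real
  assumes E1: "s * (p0 * d + p1 * c) = h - \<alpha> * (p0 * c)"
    and E2: "s * (q0 * d + q1 * c) = - (N * g) - \<alpha> * (q0 * c)"
    and E3: "s * (q0 * d' + q1 * c') = g - \<alpha> * (q0 * c')"
    and E4: "s * (p0 * d' + p1 * c') = - (N * g) - \<alpha> * (p0 * c' + g)"
  shows "h * (s * (q0 * c')) + g * (s * (p0 * c)) + N * g * (s * (p0 * c'))
    + (N + \<alpha>) * g * (s * (q0 * c)) = 0"
proof -
  \<comment> \<open>Eliminating \<open>d\<close> from \<open>E1\<close>, \<open>E2\<close> gives
    \<open>c * W\<close>, and eliminating \<open>d'\<close> from \<open>E3\<close>,
    \<open>E4\<close> gives \<open>c' * W\<close>; equating two forms of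
    \<open>s * c * c' * W\<close> removes \<open>W\<close> without division.\<close>
  define W where "W = s * (p1 * q0 - q1 * p0)"
  have 1: "c * W = h * q0 + N * g * p0"
  proof -
    have "c * W = q0 * (s * (p0 * d + p1 * c)) - p0 * (s * (q0 * d + q1 * c))"
      by (simp add: W_def algebra_simps)
    then show ?thesis
      unfolding E1 E2 by (simp add: algebra_simps)
  qed
  have 2: "c' * W = - ((N + \<alpha>) * g * q0) - g * p0"
  proof -
    have "c' * W = q0 * (s * (p0 * d' + p1 * c')) - p0 * (s * (q0 * d' + q1 * c'))"
      by (simp add: W_def algebra_simps)
    then show ?thesis
      unfolding E3 E4 by (simp add: algebra_simps)
  qed
  have "s * (c' * (h * q0 + N * g * p0)) = s * (c * (- ((N + \<alpha>) * g * q0) - g * p0))"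
    unfolding 1[symmetric] 2[symmetric] by simp
  then show ?thesis
    by (simp add: algebra_simps)
qed

text \<open>\<open>F f\<close> stands for \<open>L(f/x\<^sup>2)\<close>, so that only polynomial arguments occur; \<open>pCons 0\<close> is multiplication
  by \<open>x\<close>, hence \<open>L1 f\<close> and \<open>L0 f\<close> below are \<open>L(f/x)\<close> and \<open>L(f)\<close>.\<close>
locale semiclassical_laguerre =
  fixes F :: "real poly \<Rightarrow> real" and \<alpha> s :: real
  assumes F_add: "F (p + q) = F p + F q"
    and F_smult: "F (smult c p) = c * F p"
    and F_pos: "p \<noteq> 0 \<Longrightarrow> F (pCons 0 (pCons 0 (p * p))) > 0"
    and F_parts: "F (pCons 0 (pCons 0 (pderiv p))) =
      F (pCons 0 (pCons 0 p)) - \<alpha> * F (pCons 0 p) - s * F p"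
begin

abbreviation "L1 p \<equiv> F (pCons 0 p)"
abbreviation "L0 p \<equiv> F (pCons 0 (pCons 0 p))"

lemma F_0 [simp]: "F 0 = 0"
  using F_smult[of 0 0] by simp

lemma F_minus: "F (- p) = - F p"
  using F_smult[of "-1" p] by simp

lemma F_diff: "F (p - q) = F p - F q"
  using F_add[of p "- q"] by (simp add: F_minus)

lemma L1_add: "L1 (p + q) = L1 p + L1 q" and L1_smult: "L1 (smult c p) = c * L1 p"
  and L1_diff: "L1 (p - q) = L1 p - L1 q"
  using F_add[of "pCons 0 p" "pCons 0 q"] F_smult[of c "pCons 0 p"]
    F_diff[of "pCons 0 p" "pCons 0 q"] by simp_all

lemma L0_add: "L0 (p + q) = L0 p + L0 q" and L0_smult: "L0 (smult c p) = c * L0 p"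
  and L0_diff: "L0 (p - q) = L0 p - L0 q"
  using L1_add[of "pCons 0 p" "pCons 0 q"] L1_smult[of c "pCons 0 p"]
    L1_diff[of "pCons 0 p" "pCons 0 q"] by simp_all

lemma L0_sum: "L0 (\<Sum>i\<in>A. f i) = (\<Sum>i\<in>A. L0 (f i))"
  by (induction A rule: infinite_finite_induct) (simp_all add: L0_add)

section \<open>Monic orthogonal polynomials\<close>

definition orthogonal_monic :: "nat \<Rightarrow> real poly \<Rightarrow> bool" where
  "orthogonal_monic n p \<longleftrightarrow> degree p = n \<and> coeff p n = 1 \<and>
     (\<forall>q. (\<forall>k\<ge>n. coeff q k = 0) \<longrightarrow> L0 (p * q) = 0)"

text \<open>Gram-Schmidt applied to \<open>x^n\<close>: subtract its projections onto the lower
  \<open>Q j\<close>, whose norms are positive by \<open>F_pos\<close>.\<close>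

lemma orthogonal_monic_exists: "\<exists>p. orthogonal_monic n p"
proof (induction n rule: less_induct)
  case (less n)
  then obtain Q where Q: "\<And>j. j < n \<Longrightarrow> orthogonal_monic j (Q j)"
    by metis
  define h where "h j = L0 (Q j * Q j)" for j
  define r where "r = (\<Sum>j<n. smult (L0 (monom 1 n * Q j) / h j) (Q j))"
  define p where "p = monom 1 n - r"
  have degQ: "degree (Q j) = j" and leadQ: "coeff (Q j) j = 1" if "j < n" for j
    using Q[OF that] by (auto simp: orthogonal_monic_def)
  have hpos: "h j > 0" if "j < n" for j
    unfolding h_def using leadQ[OF that] by (intro F_pos) auto
  have QQ: "L0 (Q i * Q j) = 0" if "i < n" "j < n" "i \<noteq> j" for i j
  proof -
    have *: "L0 (Q i * Q j) = 0" if "j < i" "i < n" for i j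
      using Q[OF that(2)] that degQ[of j] unfolding orthogonal_monic_def
      by (metis coeff_eq_0 dual_order.strict_trans order_less_le_trans)
    show ?thesis
      using *[of i j] *[of j i] that by (cases "i < j") (auto simp: mult.commute)
  qed
  have rcoeff: "coeff r k = 0" if "k \<ge> n" for k
    unfolding r_def coeff_sum using that degQ by (intro sum.neutral) (auto simp: coeff_eq_0)
  have orth: "L0 (p * Q j) = 0" if "j < n" for j
  proof -
    have "L0 (r * Q j) = (\<Sum>i<n. (L0 (monom 1 n * Q i) / h i) * L0 (Q i * Q j))"
      unfolding r_def by (simp add: sum_distrib_right L0_sum L0_smult)
    also have "\<dots> = (\<Sum>i<n. if i = j then L0 (monom 1 n * Q j) else 0)"
      using that QQ hpos[OF that] by (intro sum.cong) (auto simp: h_def)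
    also have "\<dots> = L0 (monom 1 n * Q j)"
      using that by simp
    finally show ?thesis
      by (simp add: p_def left_diff_distrib L0_diff)
  qed
  \<comment> \<open>Orthogonality to each \<open>Q j\<close> extends to all \<open>q\<close> of
    degree below \<open>n\<close>: a multiple of \<open>Q m\<close> cancels the top
    coefficient.\<close>
  have "L0 (p * q) = 0" if "\<forall>k\<ge>m. coeff q k = 0" "m \<le> n" for q m
    using that
  proof (induction m arbitrary: q)
    case 0
    then have "q = 0" by (auto intro: poly_eqI)
    then show ?case by simp
  next
    case (Suc m)
    let ?q = "q - smult (coeff q m) (Q m)"
    have "coeff ?q k = 0" if "k \<ge> m" for k
      using that Suc.prems degQ[of m] leadQ[of m] by (cases "k = m") (auto simp: coeff_eq_0)
    then have "\<forall>k\<ge>m. coeff ?q k = 0" by blast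
    then have "L0 (p * ?q) = 0"
      by (rule Suc.IH) (use Suc.prems in simp)
    then show ?case
      using orth[of m] Suc.prems by (simp add: right_diff_distrib L0_diff L0_smult)
  qed
  moreover have "coeff p n = 1"
    by (simp add: p_def rcoeff)
  moreover have "degree p = n"
  proof (rule antisym)
    show "degree p \<le> n"
      by (rule degree_le) (auto simp: p_def rcoeff)
    show "n \<le> degree p"
      using \<open>coeff p n = 1\<close> by (intro le_degree) auto
  qed
  ultimately show ?case
    unfolding orthogonal_monic_def by blast
qed

definition P :: "nat \<Rightarrow> real poly" where
  "P n = (SOME p. orthogonal_monic n p)"

definition h :: "nat \<Rightarrow> real" where
  "h n = L0 (P n * P n)"

lemma P_orthogonal_monic: "orthogonal_monic n (P n)"
  unfolding P_def by (rule someI_ex[OF orthogonal_monic_exists])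

lemma P_orthogonal: "(\<And>k. k \<ge> n \<Longrightarrow> coeff q k = 0) \<Longrightarrow> L0 (P n * q) = 0"
  using P_orthogonal_monic[of n] unfolding orthogonal_monic_def by blast

lemma degree_P [simp]: "degree (P n) = n" and lead_P [simp]: "coeff (P n) n = 1"
  using P_orthogonal_monic by (auto simp: orthogonal_monic_def)

lemma coeff_P_eq_0 [simp]: "k > n \<Longrightarrow> coeff (P n) k = 0"
  by (simp add: coeff_eq_0)

lemma P_nonzero [simp]: "P n \<noteq> 0"
  using lead_P[of n] by (metis coeff_0 zero_neq_one)

lemma h_pos: "h n > 0"
  unfolding h_def by (rule F_pos) simp

lemma L0_P_mult:
  assumes "\<And>k. k > n \<Longrightarrow> coeff q k = 0"
  shows "L0 (P n * q) = coeff q n * h n"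
proof -
  let ?q = "q - smult (coeff q n) (P n)"
  have "coeff ?q k = 0" if "k \<ge> n" for k
    using that assms by (cases "k = n") auto
  then have "L0 (P n * ?q) = 0"
    by (rule P_orthogonal)
  then show ?thesis
    by (simp add: h_def right_diff_distrib L0_diff L0_smult)
qed

lemma L0_P_P: "i \<noteq> j \<Longrightarrow> L0 (P i * P j) = 0"
  using L0_P_mult[of i "P j"] L0_P_mult[of j "P i"]
  by (cases i j rule: linorder_cases) (auto simp: mult.commute)

text \<open>Split \<open>q\<close> into its constant term and \<open>x * r\<close>: the
  \<open>x\<close> cancels the \<open>1/x\<close> in \<open>L1\<close>, and \<open>r\<close> has
  degree below \<open>n\<close>.\<close>

lemma L1_P_mult:
  assumes "\<And>k. k > n \<Longrightarrow> coeff q k = 0"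
  shows "L1 (P n * q) = coeff q 0 * L1 (P n)"
proof -
  obtain a r where q: "q = pCons a r" by (cases q)
  have "coeff r k = 0" if "k \<ge> n" for k
    using assms[of "Suc k"] that by (simp add: q)
  then have "L0 (P n * r) = 0"
    by (rule P_orthogonal)
  then show ?thesis
    by (simp add: q L1_add L1_smult)
qed

lemma F_P_mult:
  assumes "\<And>k. k > Suc n \<Longrightarrow> coeff q k = 0"
  shows "F (P n * q) = coeff q 0 * F (P n) + coeff q 1 * L1 (P n)"
proof -
  obtain a r where q: "q = pCons a r" by (cases q)
  have "L1 (P n * r) = coeff r 0 * L1 (P n)"
    using assms[of "Suc k" for k] by (intro L1_P_mult) (simp add: q)
  then show ?thesis
    by (simp add: q F_add F_smult)
qed

section \<open>Relations between \<open>h\<close>, \<open>a\<close> and \<open>b\<close>\<close>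

lemma coeff_pCons_0_pderiv: "coeff (pCons 0 (pderiv p)) k = of_nat k * coeff p k"
  by (cases k) (simp_all add: coeff_pderiv)

definition a :: "nat \<Rightarrow> real" where "a n = s * L1 (P n * P n) / h n"

text \<open>In the three-term recurrence \<open>x P\<^sub>n = P\<^sub>n\<^sub>+\<^sub>1 + \<alpha>\<^sub>n P\<^sub>n + \<beta>\<^sub>n P\<^sub>n\<^sub>-\<^sub>1\<close>, this says \<open>\<alpha>\<^sub>n = 2 n + 1 + \<alpha> + a\<^sub>n\<close>.\<close>
lemma subleading_step:
  "coeff (pCons 0 (P n)) n - coeff (P (Suc n)) n = 2 * real n + 1 + \<alpha> + a n"
proof -
  let ?p = "pCons 0 (P n)"
  have "coeff (?p - P (Suc n)) k = 0" if "k > n" for k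
    using that by (cases "k = Suc n") (auto simp: coeff_pCons split: nat.split)
  then have "L0 (P n * (?p - P (Suc n))) = coeff (?p - P (Suc n)) n * h n"
    by (rule L0_P_mult)
  then have 1: "L0 (P n * ?p) = (coeff ?p n - coeff (P (Suc n)) n) * h n"
    by (simp add: right_diff_distrib L0_diff L0_P_P del: mult_pCons_right)
  have "L0 (P n * pCons 0 (pderiv (P n))) = real n * h n"
    by (subst L0_P_mult) (simp_all add: coeff_pCons_0_pderiv del: mult_pCons_right)
  \<comment> \<open>The extra factor \<open>x\<close> turns the \<open>s\<close> term of
    \<open>F_parts\<close> into \<open>s * L1 (P n * P n)\<close>, that is
    \<open>a n * h n\<close>.\<close>
  moreover have "pderiv (pCons 0 (P n * P n)) =
      P n * P n + (P n * pCons 0 (pderiv (P n)) + P n * pCons 0 (pderiv (P n)))"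
    by (simp add: pderiv_pCons pderiv_mult)
  ultimately have "L0 (pderiv (pCons 0 (P n * P n))) = h n + 2 * (real n * h n)"
    by (simp only: L0_add) (simp add: h_def)
  moreover have "s * L1 (P n * P n) = a n * h n"
    using h_pos[of n] by (simp add: a_def)
  ultimately have "(coeff ?p n - coeff (P (Suc n)) n) * h n = (2 * real n + 1 + \<alpha> + a n) * h n"
    using F_parts[of "pCons 0 (P n * P n)"] 1 by (simp add: h_def algebra_simps)
  then show ?thesis
    using h_pos[of n] by simp
qed

text \<open>Multiplication by \<open>x\<close> shifts coefficients, so
  \<open>subleading_step\<close> telescopes.\<close>

lemma subleading_P:
  "coeff (P (Suc n)) n = - (\<Sum>j\<le>n. a j) - real (Suc n) * (real (Suc n) + \<alpha>)"
proof (induction n)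
  case 0
  show ?case using subleading_step[of 0] by simp
next
  case (Suc n)
  then show ?case using subleading_step[of "Suc n"] by (simp add: algebra_simps)
qed

text \<open>The index is the lower of the two degrees: this is the b of the overview at
  \<open>Suc n\<close>.\<close>

definition b :: "nat \<Rightarrow> real" where "b n = s * L1 (P (Suc n) * P n) / h n"

lemma s_L1_P_P: "s * L1 (P (Suc n) * P n) = b n * h n" "s * L1 (P n * P n) = a n * h n"
  using h_pos[of n] by (simp_all add: a_def b_def)

lemma L0_P_pderiv_P: "L0 (P n * pderiv (P (Suc n))) = real (Suc n) * h n"
  "L0 (P n * pderiv (P n)) = 0" "L0 (P (Suc n) * pderiv (P n)) = 0"
  by (subst L0_P_mult; simp add: coeff_pderiv)+

text \<open>Integration by parts for \<open>x * P (Suc n) * P n\<close>; the derivative side reduces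
  to the subleading coefficient of \<open>P (Suc n)\<close>.\<close>

lemma beta_formula:
  "h (Suc n) = (real (Suc n) * (real (Suc n) + \<alpha>) + b n + (\<Sum>j\<le>n. a j)) * h n"
proof -
  \<comment> \<open>The leading terms cancel, leaving degree at most \<open>n\<close>.\<close>
  let ?q = "pCons 0 (pderiv (P (Suc n))) - smult (real (Suc n)) (P (Suc n))"
  have "coeff ?q k = 0" if "k > n" for k
    using that by (cases "k = Suc n") (auto simp: coeff_pCons_0_pderiv simp del: coeff_pCons_Suc)
  then have "L0 (P n * ?q) = coeff ?q n * h n"
    by (rule L0_P_mult)
  then have 1: "L0 (P n * pCons 0 (pderiv (P (Suc n)))) = - coeff (P (Suc n)) n * h n"
    by (simp add: right_diff_distrib L0_diff L0_smult L0_P_P coeff_pCons_0_pderiv algebra_simps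
        del: mult_pCons_right)
  have 2: "L0 (P (Suc n) * pCons 0 (P n)) = h (Suc n)"
    by (subst L0_P_mult) (simp_all add: coeff_pCons split: nat.split del: mult_pCons_right)
  have 3: "L0 (P (Suc n) * pCons 0 (pderiv (P n))) = 0"
    by (subst L0_P_mult) (simp_all add: coeff_pCons_0_pderiv coeff_pderiv del: mult_pCons_right)
  have "pderiv (pCons 0 (P (Suc n) * P n)) = P (Suc n) * P n
      + P (Suc n) * pCons 0 (pderiv (P n)) + P n * pCons 0 (pderiv (P (Suc n)))"
    by (simp add: pderiv_pCons pderiv_mult)
  then have "L0 (pderiv (pCons 0 (P (Suc n) * P n))) = - coeff (P (Suc n)) n * h n"
    using 1 3 by (simp only: L0_add) (simp add: L0_P_P)
  then show ?thesis
    using F_parts[of "pCons 0 (P (Suc n) * P n)"] 2 L0_P_P[of "Suc n" n] s_L1_P_P(1)[of n]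
    by (simp add: subleading_P algebra_simps)
qed

text \<open>Either factor can be split into its constant term and \<open>x * r\<close>. Splitting
  \<open>P (Suc n)\<close> leaves a monic \<open>r\<close> of degree \<open>n\<close>, whence the
  extra \<open>h n\<close>.\<close>

lemma L1_P_Suc_P:
  "L1 (P (Suc n) * P n) = coeff (P n) 0 * L1 (P (Suc n))"
  "L1 (P (Suc n) * P n) = coeff (P (Suc n)) 0 * L1 (P n) + h n"
  "L1 (P n * P n) = coeff (P n) 0 * L1 (P n)"
proof -
  obtain c r where r: "P (Suc n) = pCons c r" by (cases "P (Suc n)")
  have "coeff r k = coeff (P (Suc n)) (Suc k)" for k
    by (simp add: r)
  then have "L0 (P n * r) = h n"
    by (subst L0_P_mult) simp_all
  then show "L1 (P (Suc n) * P n) = coeff (P (Suc n)) 0 * L1 (P n) + h n"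
    by (simp add: r L1_add L1_smult mult.commute[of _ "P n"])
qed (simp_all add: L1_P_mult)

text \<open>\<open>b n * h n\<close> and \<open>(b n - s) * h n\<close> are each \<open>s\<close>
  times a value at 0 times an \<open>L1\<close> value; regrouping these factors by index gives the
  two diagonal values of \<open>L1\<close>.\<close>

lemma b_quadratic:
  "(b n * b n - s * b n) * h n = h (Suc n) * a (Suc n) * a n"
proof -
  have "b n * h n = s * (coeff (P n) 0 * L1 (P (Suc n)))"
    using s_L1_P_P(1)[of n] L1_P_Suc_P(1)[of n] by simp
  moreover have "(b n - s) * h n = s * (coeff (P (Suc n)) 0 * L1 (P n))"
    using s_L1_P_P(1)[of n] L1_P_Suc_P(2)[of n] by (simp add: algebra_simps)
  ultimately have "(b n * h n) * ((b n - s) * h n) =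
      (s * L1 (P (Suc n) * P (Suc n))) * (s * L1 (P n * P n))"
    by (simp add: L1_P_Suc_P(3))
  then have "((b n * b n - s * b n) * h n) * h n = (h (Suc n) * a (Suc n) * a n) * h n"
    by (simp add: s_L1_P_P algebra_simps)
  then show ?thesis
    using h_pos[of n] by simp
qed

text \<open>Here \<open>F_parts\<close> is applied without an extra factor \<open>x\<close>, so
  unknowns \<open>F (P m)\<close> appear; \<open>b_linear_elimination\<close> removes them.\<close>

lemma b_linear:
  "(real (Suc n) * s - (2 * real (Suc n) + \<alpha>) * b n) * h n = h (Suc n) * (a (Suc n) + a n)"
proof -
  let ?P0 = "coeff (P (Suc n)) 0" and ?Q0 = "coeff (P n) 0"
  let ?P1 = "coeff (P (Suc n)) 1" and ?Q1 = "coeff (P n) 1"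
  let ?c = "L1 (P (Suc n))" and ?d = "F (P (Suc n))"
  let ?c' = "L1 (P n)" and ?d' = "F (P n)"
  let ?g = "h n" and ?h = "h (Suc n)"
  have diag: "s * (coeff (P m) 0 * F (P m) + coeff (P m) 1 * L1 (P m)) =
      h m - \<alpha> * (coeff (P m) 0 * L1 (P m))" for m
    using F_parts[of "P m * P m"] F_P_mult[of m "P m"] L1_P_mult[of m "P m"]
    unfolding pderiv_mult L0_add L0_P_pderiv_P by (simp add: h_def)
  have off: "s * F (P (Suc n) * P n) = - (real (Suc n) * ?g) - \<alpha> * L1 (P (Suc n) * P n)"
    using F_parts[of "P (Suc n) * P n"]
    unfolding pderiv_mult L0_add L0_P_pderiv_P by (simp add: L0_P_P)
  have F1: "F (P (Suc n) * P n) = ?Q0 * ?d + ?Q1 * ?c"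
    by (rule F_P_mult) simp
  have F2: "F (P (Suc n) * P n) = ?P0 * ?d' + ?P1 * ?c'"
    using F_P_mult[of n "P (Suc n)"] by (simp add: mult.commute)
  note E1 = diag[of "Suc n"] and E3 = diag[of n]
  have E2: "s * (?Q0 * ?d + ?Q1 * ?c) = - (real (Suc n) * ?g) - \<alpha> * (?Q0 * ?c)"
    using off F1 L1_P_Suc_P(1)[of n] by simp
  have E4: "s * (?P0 * ?d' + ?P1 * ?c') = - (real (Suc n) * ?g) - \<alpha> * (?P0 * ?c' + ?g)"
    using off F2 L1_P_Suc_P(2)[of n] by simp
  define N where "N = real (Suc n)"
  note key = b_linear_elimination[OF E1 E2 E3 E4, folded N_def]
  have A: "s * (?P0 * ?c) = a (Suc n) * ?h" "s * (?Q0 * ?c') = a n * ?g"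
      "s * (?Q0 * ?c) = b n * ?g" "s * (?P0 * ?c') = (b n - s) * ?g"
    using s_L1_P_P[of n] s_L1_P_P(2)[of "Suc n"] L1_P_Suc_P[of n] L1_P_Suc_P(3)[of "Suc n"]
    by (simp_all add: algebra_simps)
  have "((N * s - (2 * N + \<alpha>) * b n) * ?g) * ?g = (?h * (a (Suc n) + a n)) * ?g"
    using key unfolding A by (simp add: algebra_simps)
  then show ?thesis
    using h_pos[of n] by (simp add: N_def)
qed

lemma sigma_identity:
  fixes n :: nat
  defines "m \<equiv> real (Suc n)" and "H \<equiv> - (\<Sum>j\<le>n. a j)" and "\<delta> \<equiv> a n + a (Suc n)"
  shows "((H - m * (m + \<alpha>)) * \<delta> + m * s) * ((H - m * (m + \<alpha>) - s) * \<delta> - (m + \<alpha>) * s)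
    = (2 * m + \<alpha> + \<delta>) * (m * s + (2 * m + \<alpha>) * (m * (m + \<alpha>) - H)) * a (Suc n) * a n"
proof -
  define \<beta> where "\<beta> = h (Suc n) / h n"
  have h: "h (Suc n) = \<beta> * h n"
    using h_pos[of n] by (simp add: \<beta>_def)
  have 1: "\<beta> = m * (m + \<alpha>) + b n - H"
    using beta_formula[of n] h_pos[of n] by (simp add: h m_def H_def)
  have 2: "m * s - (2 * m + \<alpha>) * b n = \<beta> * \<delta>"
  proof -
    have "(m * s - (2 * m + \<alpha>) * b n) * h n = \<beta> * \<delta> * h n"
      using b_linear[of n] by (simp add: h m_def \<delta>_def mult_ac add.commute)
    then show ?thesis using h_pos[of n] by simp
  qed
  have 3: "b n * b n - s * b n = \<beta> * a (Suc n) * a n"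
  proof -
    have "(b n * b n - s * b n) * h n = \<beta> * a (Suc n) * a n * h n"
      using b_quadratic[of n] by (simp add: h mult_ac)
    then show ?thesis using h_pos[of n] by simp
  qed
  \<comment> \<open>By \<open>1\<close>, \<open>H - m * (m + \<alpha>)\<close> is
    \<open>b n - \<beta>\<close>; replacing \<open>\<beta> * \<delta>\<close> by means of
    \<open>2\<close> then splits \<open>K\<close> off each brace.\<close>
  define K where "K = 2 * m + \<alpha> + \<delta>"
  have "(H - m * (m + \<alpha>)) * \<delta> + m * s = b n * K"
    using 2 unfolding 1 K_def by (simp add: algebra_simps)
  moreover have "(H - m * (m + \<alpha>) - s) * \<delta> - (m + \<alpha>) * s = (b n - s) * K"
    using 2 unfolding 1 K_def by (simp add: algebra_simps)
  moreover have "m * s + (2 * m + \<alpha>) * (m * (m + \<alpha>) - H) = \<beta> * K"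
    using 2 unfolding 1 K_def by (simp add: algebra_simps)
  moreover have "b n * K * ((b n - s) * K) = K * (\<beta> * K) * a (Suc n) * a n"
  proof -
    have "b n * K * ((b n - s) * K) = (b n * b n - s * b n) * (K * K)"
      by (simp add: algebra_simps)
    then show ?thesis by (simp add: 3)
  qed
  ultimately show ?thesis
    by (simp only: K_def)
qed

end

section \<open>Integrals against the weight\<close>

lemma power_le_fact_exp:
  fixes y :: real assumes "y \<ge> 0" shows "y ^ k \<le> fact k * exp y"
proof -
  have "y ^ k / fact k \<le> exp y"
    using sum_le_suminf[OF summable_exp_generic[of y], of "{k}"] assms
    by (simp add: exp_def divide_inverse mult.commute)
  then show ?thesis
    by (simp add: field_simps)
qed

text \<open>Both signs of \<open>y\<close> rest on \<open>1 + z <= exp z\<close>. This controls the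
  remainder when differentiating under the integral.\<close>

lemma exp_remainder_bound:
  fixes y :: real shows "\<bar>exp y - 1 - y\<bar> \<le> y\<^sup>2 * exp \<bar>y\<bar>"
proof -
  have 0: "exp y - 1 - y \<ge> 0"
    using exp_ge_add_one_self[of y] by linarith
  have "exp y * (1 - y) \<le> exp y * exp (- y)"
    using exp_ge_add_one_self[of "- y"] by (intro mult_left_mono) auto
  then have 1: "exp y - 1 - y \<le> y * (exp y - 1)"
    by (simp add: exp_minus algebra_simps)
  have "y * (exp y - 1) \<le> y\<^sup>2 * exp \<bar>y\<bar>"
  proof (cases "y \<ge> 0")
    case True
    have "exp y * (1 - y) \<le> 1"
      using 1 by (simp add: algebra_simps)
    then have "y * (exp y - 1) \<le> y * (y * exp y)"
      using True by (intro mult_left_mono) (auto simp: algebra_simps)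
    then show ?thesis
      using True by (simp add: power2_eq_square mult_ac)
  next
    case False
    have "y * (exp y - 1) = (- y) * (1 - exp y)"
      by (simp add: algebra_simps)
    also have "\<dots> \<le> (- y) * (- y)"
      using False exp_ge_add_one_self[of y] by (intro mult_left_mono) linarith+
    also have "\<dots> \<le> y\<^sup>2 * exp \<bar>y\<bar>"
      by (simp add: power2_eq_square mult_le_cancel_left1)
    finally show ?thesis .
  qed
  with 0 1 show ?thesis by linarith
qed

text \<open>The exponent is a free real parameter because dividing by \<open>x\<close> and
  differentiating in \<open>t\<close> both lower it.\<close>

definition weight :: "real \<Rightarrow> real \<Rightarrow> real \<Rightarrow> real" where
  "weight \<beta> t x = x powr \<beta> * exp (- x - t / x)"

definition moment :: "real \<Rightarrow> real poly \<Rightarrow> real \<Rightarrow> real" where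
  "moment \<beta> p t = (LBINT x:{0<..}. poly p x * weight \<beta> t x)"

lemma weight_nonneg [simp]: "weight \<beta> t x \<ge> 0"
  by (simp add: weight_def)

lemma weight_mult: "x > 0 \<Longrightarrow> x * weight \<beta> t x = weight (\<beta> + 1) t x"
  by (simp add: weight_def powr_add)

text \<open>Near 0, \<open>exp (- t / x)\<close> absorbs any negative power of \<open>x\<close>; for
  large \<open>x\<close>, half the decay of \<open>exp (- x)\<close> absorbs any positive one. The
  two cases give the two summands of \<open>?C\<close>.\<close>

lemma weight_bound:
  assumes "t > 0"
  obtains C where "\<And>x. x > 0 \<Longrightarrow> weight \<beta> t x \<le> C * exp (- x / 2)"
proof -
  obtain k :: nat where k: "\<bar>\<beta>\<bar> \<le> real k"
    using real_arch_simple by blast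
  let ?C = "fact k / t ^ k + fact k * 2 ^ k :: real"
  have "weight \<beta> t x \<le> ?C * exp (- x / 2)" if "x > 0" for x
  proof (cases "x \<ge> 1")
    case True
    have "x powr \<beta> \<le> x powr real k"
      using True k by (intro powr_mono) auto
    also have "\<dots> = 2 ^ k * (x / 2) ^ k"
      using that by (simp add: powr_realpow power_divide)
    also have "\<dots> \<le> 2 ^ k * (fact k * exp (x / 2))"
      using that by (intro mult_left_mono power_le_fact_exp) auto
    finally have 1: "x powr \<beta> \<le> fact k * 2 ^ k * exp (x / 2)"
      by (simp add: mult_ac)
    have "weight \<beta> t x \<le> (fact k * 2 ^ k * exp (x / 2)) * exp (- x)"
      unfolding weight_def using that assms by (intro mult_mono 1) auto
    also have "\<dots> = fact k * 2 ^ k * (exp (x / 2) * exp (- x))"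
      by simp
    also have "\<dots> = fact k * 2 ^ k * exp (- x / 2)"
      by (simp flip: exp_add)
    also have "\<dots> \<le> ?C * exp (- x / 2)"
      using assms by (intro mult_right_mono) auto
    finally show ?thesis .
  next
    case False
    have "x powr \<beta> \<le> x powr (- real k)"
      using False that k by (intro powr_mono') auto
    also have "\<dots> = (t / x) ^ k / t ^ k"
      using that assms by (simp add: powr_minus powr_realpow power_mult_distrib divide_inverse power_inverse)
    also have "\<dots> \<le> fact k * exp (t / x) / t ^ k"
      using that assms by (intro divide_right_mono power_le_fact_exp) auto
    finally have 1: "x powr \<beta> \<le> fact k / t ^ k * exp (t / x)"
      by simp
    have "weight \<beta> t x \<le> (fact k / t ^ k * exp (t / x)) * exp (- x - t / x)"
      unfolding weight_def by (intro mult_mono 1) (use assms in auto)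
    also have "\<dots> = fact k / t ^ k * (exp (t / x) * exp (- x - t / x))"
      by simp
    also have "\<dots> = fact k / t ^ k * exp (- x)"
      by (simp flip: exp_add)
    also have "\<dots> \<le> ?C * exp (- x / 2)"
      using assms that by (intro mult_mono) auto
    finally show ?thesis .
  qed
  then show ?thesis by (rule that)
qed

lemma set_integrable_exp_half: "set_integrable lborel {0<..} (\<lambda>x::real. exp (- x / 2))"
proof -
  have "(\<lambda>x::real. exp (- (1/2) * x)) absolutely_integrable_on {0..}"
    by (intro nonnegative_absolutely_integrable_1 integrable_on_exp_minus_to_infinity) auto
  then have "set_integrable lebesgue {0<..} (\<lambda>x::real. exp (- (1/2) * x))"
    by (rule set_integrable_subset) auto
  \<comment> \<open>Borel measurability lets integrability descend from the completed measure to
    \<open>lborel\<close>.\<close>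
  moreover have "(\<lambda>x::real. indicat_real {0<..} x *\<^sub>R exp (- (1/2) * x)) \<in> borel_measurable lborel"
    by measurable
  ultimately have "set_integrable lborel {0<..} (\<lambda>x::real. exp (- (1/2) * x))"
    unfolding set_integrable_def by (simp only: integrable_completion)
  then show ?thesis by simp
qed

lemma set_integrable_weight:
  assumes "t > 0"
  shows "set_integrable lborel {0<..} (weight \<beta> t)"
proof -
  obtain C where C: "\<And>x. x > 0 \<Longrightarrow> weight \<beta> t x \<le> C * exp (- x / 2)"
    using weight_bound[OF assms] by blast
  have "set_integrable lborel {0<..} (\<lambda>x. C * exp (- x / 2))"
    using set_integrable_exp_half by simp
  moreover have "set_borel_measurable lborel {0<..} (weight \<beta> t)"
    unfolding set_borel_measurable_def weight_def by measurable
  ultimately show ?thesis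
    by (rule set_integrable_bound) (auto intro!: AE_I2 order_trans[OF C])
qed

lemma set_integrable_poly_weight:
  assumes "t > 0"
  shows "set_integrable lborel {0<..} (\<lambda>x. poly p x * weight \<beta> t x)"
proof (induction p arbitrary: \<beta>)
  case 0
  then show ?case by (simp add: set_integrable_def)
next
  case (pCons c p)
  have "set_integrable lborel {0<..} (\<lambda>x. c * weight \<beta> t x + poly p x * weight (\<beta> + 1) t x)"
    using set_integrable_weight[OF assms] pCons.IH by (intro set_integral_add) auto
  also have "?this \<longleftrightarrow> set_integrable lborel {0<..} (\<lambda>x. poly (pCons c p) x * weight \<beta> t x)"
    by (intro set_integrable_cong) (auto simp: distrib_right mult.assoc mult.left_commute simp flip: weight_mult)
  finally show ?case .
qed

lemma moment_0 [simp]: "moment \<beta> 0 t = 0"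
  by (simp add: moment_def)

lemma moment_add:
  "t > 0 \<Longrightarrow> moment \<beta> (p + q) t = moment \<beta> p t + moment \<beta> q t"
  unfolding moment_def poly_add distrib_right by (intro set_integral_add set_integrable_poly_weight)

lemma moment_smult: "moment \<beta> (smult c p) t = c * moment \<beta> p t"
  unfolding moment_def poly_smult mult.assoc by (rule set_integral_mult_right)

lemma moment_sum:
  "t > 0 \<Longrightarrow> moment \<beta> (\<Sum>i\<in>A. f i) t = (\<Sum>i\<in>A. moment \<beta> (f i) t)"
  by (induction A rule: infinite_finite_induct) (simp_all add: moment_add)

lemma moment_pCons_0: "moment \<beta> (pCons 0 p) t = moment (\<beta> + 1) p t"
  unfolding moment_def by (intro set_lebesgue_integral_cong) (auto simp flip: weight_mult)

lemma moment_pCons: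
  "t > 0 \<Longrightarrow> moment \<beta> (pCons c p) t = c * moment \<beta> 1 t + moment (\<beta> + 1) p t"
  using moment_add[of t \<beta> "smult c 1" "pCons 0 p"] moment_smult[of \<beta> c 1 t]
  by (simp add: moment_pCons_0)

text \<open>A zero integral would make the integrand vanish almost everywhere, but it is positive on
  the half-line off the finitely many roots of \<open>p\<close>.\<close>

lemma moment_square_pos:
  assumes "t > 0" "p \<noteq> 0"
  shows "moment \<beta> (p * p) t > 0"
proof -
  let ?f = "\<lambda>x. indicat_real {0<..} x *\<^sub>R (poly (p * p) x * weight \<beta> t x)"
  have int: "integrable lborel ?f"
    using set_integrable_poly_weight[OF assms(1)] unfolding set_integrable_def .
  have nonneg: "?f x \<ge> 0" for x
    by (simp add: indicator_def)
  have eq: "moment \<beta> (p * p) t = integral\<^sup>L lborel ?f"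
    by (simp add: moment_def set_lebesgue_integral_def)
  have "moment \<beta> (p * p) t \<noteq> 0"
  proof
    assume "moment \<beta> (p * p) t = 0"
    then have "AE x in lborel. ?f x = 0"
      using integral_nonneg_eq_0_iff_AE[OF int] nonneg eq by simp
    moreover have "AE x in lborel. x \<notin> {x. poly p x = 0}"
      using poly_roots_finite[OF assms(2)]
      by (intro AE_not_in countable_imp_null_set_lborel countable_finite)
    ultimately have "AE x in lborel. x \<notin> {0<..(1::real)}"
      by eventually_elim (auto simp: weight_def)
    then have "emeasure lborel {0<..(1::real)} = 0"
      using AE_iff_null_sets[of "{0<..1::real}" lborel] by (simp add: null_setsD1)
    then show False
      using emeasure_lborel_Ioc[of 0 1] by simp
  qed
  then show ?thesis
    using nonneg unfolding eq by (intro le_neq_trans integral_nonneg_AE) auto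
qed

lemma moment_1_derivative:
  assumes "t > 0"
  shows "((\<lambda>u. moment \<beta> 1 u) has_real_derivative - moment (\<beta> - 1) 1 t) (at t)"
proof -
  have eq: "moment \<gamma> 1 u = (LBINT x:{0<..}. weight \<gamma> u x)" for \<gamma> u
    by (simp add: moment_def)
  \<comment> \<open>Since \<open>\<bar>y\<bar> <= t / 2 / x\<close> below, the remainder factor
    \<open>exp \<bar>y\<bar>\<close> uses up at most half of \<open>exp (- t / x)\<close>, and
    \<open>y\<^sup>2\<close> costs two powers of \<open>x\<close>.\<close>
  define C where "C = moment (\<beta> - 2) 1 (t / 2)"
  have bound: "\<bar>moment \<beta> 1 u - moment \<beta> 1 t + (u - t) * moment (\<beta> - 1) 1 t\<bar> \<le> C * (u - t)\<^sup>2"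
    if u: "\<bar>u - t\<bar> < t / 2" for u
  proof -
    have "u > 0" "t / 2 > 0" using u assms by linarith+
    note int = set_integrable_weight[OF this(1)] set_integrable_weight[OF this(2)]
      set_integrable_weight[OF assms]
    let ?r = "\<lambda>x. weight \<beta> u x - weight \<beta> t x + (u - t) * weight (\<beta> - 1) t x"
    have rint: "set_integrable lborel {0<..} ?r"
      using int by (intro set_integral_add set_integral_diff set_integrable_mult_right)
    have le: "\<bar>?r x\<bar> \<le> (u - t)\<^sup>2 * weight (\<beta> - 2) (t / 2) x" if "x > 0" for x
    proof -
      define y where "y = (t - u) / x"
      have y: "\<bar>y\<bar> \<le> t / 2 / x"
        using divide_right_mono[of "\<bar>u - t\<bar>" "t / 2" x] u that
        by (simp add: y_def abs_divide abs_minus_commute)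
      have e: "exp (- x - u / x) = exp (- x - t / x) * exp y"
        unfolding exp_add[symmetric] by (simp add: y_def diff_divide_distrib)
      have "?r x = weight \<beta> t x * (exp y - 1 - y)"
      proof -
        have "weight \<beta> u x = weight \<beta> t x * exp y"
          by (simp add: weight_def e)
        moreover have "(u - t) * weight (\<beta> - 1) t x = - (weight \<beta> t x * y)"
          using that by (simp add: weight_def powr_diff y_def field_simps)
        ultimately show ?thesis by (simp add: algebra_simps)
      qed
      then have "\<bar>?r x\<bar> = weight \<beta> t x * \<bar>exp y - 1 - y\<bar>"
        by (simp add: abs_mult)
      also have "\<dots> \<le> weight \<beta> t x * (y\<^sup>2 * exp (t / 2 / x))"
        by (intro mult_left_mono order_trans[OF exp_remainder_bound] mult_mono) (use y in auto)
      also have "\<dots> = (u - t)\<^sup>2 * (x powr \<beta> / x\<^sup>2) * (exp (- x - t / x) * exp (t / 2 / x))"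
        by (simp add: weight_def y_def power_divide power2_commute)
      also have "x powr \<beta> / x\<^sup>2 = x powr (\<beta> - 2)"
        using that by (simp add: powr_diff)
      also have "exp (- x - t / x) * exp (t / 2 / x) = exp (- x - t / 2 / x)"
        by (simp flip: exp_add)
      finally show ?thesis by (simp add: weight_def)
    qed
    have integral_eq: "moment \<beta> 1 u - moment \<beta> 1 t + (u - t) * moment (\<beta> - 1) 1 t =
        (LBINT x:{0<..}. ?r x)"
      unfolding eq using int
      by (subst set_integral_add set_integral_diff; (intro set_integral_diff set_integrable_mult_right)?; simp)+
    have "\<bar>LBINT x:{0<..}. ?r x\<bar> \<le> (LBINT x:{0<..}. \<bar>?r x\<bar>)"
      using set_integral_norm_bound[OF rint] by simp
    also have "\<dots> \<le> (LBINT x:{0<..}. (u - t)\<^sup>2 * weight (\<beta> - 2) (t / 2) x)"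
    proof (rule set_integral_mono)
      show "set_integrable lborel {0<..} (\<lambda>x. \<bar>?r x\<bar>)"
        using rint by (rule set_integrable_abs)
      show "set_integrable lborel {0<..} (\<lambda>x. (u - t)\<^sup>2 * weight (\<beta> - 2) (t / 2) x)"
        using int(2) by (rule set_integrable_mult_right)
      show "\<bar>?r x\<bar> \<le> (u - t)\<^sup>2 * weight (\<beta> - 2) (t / 2) x" if "x \<in> {0<..}" for x
        using that by (intro le) simp
    qed
    also have "\<dots> = C * (u - t)\<^sup>2"
      by (simp add: C_def eq)
    finally show ?thesis
      unfolding integral_eq .
  qed
  have "((\<lambda>u. (moment \<beta> 1 u - moment \<beta> 1 t) / (u - t) - (- moment (\<beta> - 1) 1 t)) \<longlongrightarrow> 0) (at t)"
  proof (rule Lim_null_comparison)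
    have "\<forall>\<^sub>F u in at t. u \<noteq> t \<and> \<bar>u - t\<bar> < t / 2"
      unfolding eventually_at using assms by (intro exI[of _ "t / 2"]) (auto simp: dist_real_def)
    then show "\<forall>\<^sub>F u in at t. norm ((moment \<beta> 1 u - moment \<beta> 1 t) / (u - t) - (- moment (\<beta> - 1) 1 t))
        \<le> C * \<bar>u - t\<bar>"
    proof eventually_elim
      case (elim u)
      let ?r = "moment \<beta> 1 u - moment \<beta> 1 t + (u - t) * moment (\<beta> - 1) 1 t"
      have quotient: "(moment \<beta> 1 u - moment \<beta> 1 t) / (u - t) - (- moment (\<beta> - 1) 1 t) = ?r / (u - t)"
        using elim by (simp add: field_simps)
      have "\<bar>?r\<bar> \<le> C * \<bar>u - t\<bar> * \<bar>u - t\<bar>"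
        using bound[of u] elim by (simp add: power2_eq_square mult.assoc)
      then show ?case
        unfolding quotient using elim by (simp add: pos_divide_le_eq)
    qed
    show "((\<lambda>u. C * \<bar>u - t\<bar>) \<longlongrightarrow> 0) (at t)"
      by (auto intro!: tendsto_eq_intros)
  qed
  then show ?thesis
    unfolding has_field_derivative_iff using LIM_zero_iff by blast
qed

lemma moment_derivative:
  assumes "t > 0"
  shows "((\<lambda>u. moment \<beta> p u) has_real_derivative - moment (\<beta> - 1) p t) (at t)"
proof (induction p arbitrary: \<beta>)
  case 0
  then show ?case by simp
next
  case (pCons c p)
  have "((\<lambda>u. c * moment \<beta> 1 u + moment (\<beta> + 1) p u) has_real_derivative
      c * (- moment (\<beta> - 1) 1 t) + (- moment \<beta> p t)) (at t)"
    using pCons.IH[of "\<beta> + 1"] by (intro DERIV_add DERIV_cmult moment_1_derivative assms) simp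
  moreover have "\<forall>\<^sub>F u in nhds t. u > 0"
    using eventually_nhds_in_open[of "{0<..}" t] assms by simp
  then have "\<forall>\<^sub>F u in nhds t. moment \<beta> (pCons c p) u = c * moment \<beta> 1 u + moment (\<beta> + 1) p u"
    by eventually_elim (rule moment_pCons)
  ultimately show ?case
    using DERIV_cong_ev[of t t] assms by (simp add: moment_pCons)
qed

text \<open>The fundamental theorem of calculus for \<open>weight \<beta> t\<close>, which vanishes
  at both ends; \<open>?f\<close> is its derivative.\<close>

lemma moment_1_parts:
  assumes "t > 0"
  shows "moment \<beta> 1 t - \<beta> * moment (\<beta> - 1) 1 t - t * moment (\<beta> - 2) 1 t = 0"
proof -
  let ?f = "\<lambda>x. \<beta> * weight (\<beta> - 1) t x + t * weight (\<beta> - 2) t x - weight \<beta> t x"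
  note int = set_integrable_weight[OF assms]
  have fint: "set_integrable lborel {0<..} ?f"
    using int by (intro set_integral_add set_integral_diff set_integrable_mult_right)
  obtain C where C: "\<And>x. x > 0 \<Longrightarrow> weight \<beta> t x \<le> C * exp (- x / 2)"
    using weight_bound[OF assms] by blast
  \<comment> \<open>For the limit at 0: \<open>weight \<beta> t x\<close> is \<open>x\<close> times
    a bounded quantity.\<close>
  obtain C' where C': "\<And>x. x > 0 \<Longrightarrow> weight (\<beta> - 1) t x \<le> C' * exp (- x / 2)"
    using weight_bound[OF assms] by blast
  have ei: "einterval 0 \<infinity> = {0<..}"
    by (auto simp: einterval_def zero_ereal_def)
  have "(LBINT x=0..\<infinity>. ?f x) = 0 - 0"
  proof (rule interval_integral_FTC_integrable)
    fix x :: real assume "0 < ereal x" "ereal x < \<infinity>"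
    then have x: "x > 0" by (simp add: zero_ereal_def)
    have "((weight \<beta> t) has_real_derivative ?f x) (at x)"
      unfolding weight_def using x
      by (auto intro!: derivative_eq_intros
          simp: powr_diff field_simps power2_eq_square)
    then show "(weight \<beta> t has_vector_derivative ?f x) (at x)"
      by (simp add: has_real_derivative_iff_has_vector_derivative)
    show "isCont ?f x"
      unfolding weight_def using x by (auto intro!: continuous_intros)
  next
    show "set_integrable lborel (einterval 0 \<infinity>) ?f"
      using fint by (simp add: ei)
  next
    have "(weight \<beta> t \<longlongrightarrow> 0) (at_right 0)"
    proof (rule Lim_null_comparison)
      have "\<forall>\<^sub>F x in at_right 0. x > (0::real)"
        by (rule eventually_at_right_less)
      then show "\<forall>\<^sub>F x in at_right 0. norm (weight \<beta> t x) \<le> x * (C' * exp (- x / 2))"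
        using weight_mult[of _ "\<beta> - 1" t] C'
        by (auto elim!: eventually_mono) (metis less_imp_le mult_left_mono)
      show "((\<lambda>x. x * (C' * exp (- x / 2))) \<longlongrightarrow> 0) (at_right 0)"
        by (auto intro!: tendsto_eq_intros)
    qed
    then show "((weight \<beta> t \<circ> real_of_ereal) \<longlongrightarrow> 0) (at_right 0)"
      by (simp add: zero_ereal_def ereal_tendsto_simps)
  next
    have "(weight \<beta> t \<longlongrightarrow> 0) at_top"
    proof (rule Lim_null_comparison)
      have "\<forall>\<^sub>F x in at_top. x > (0::real)"
        by (rule eventually_gt_at_top)
      then show "\<forall>\<^sub>F x in at_top. norm (weight \<beta> t x) \<le> C * exp (- x / 2)"
        by eventually_elim (use C in simp)
      have "filterlim (\<lambda>x::real. - x / 2) at_bot at_top"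
        unfolding filterlim_at_bot
      proof
        fix z :: real
        show "\<forall>\<^sub>F x in at_top. - x / 2 \<le> z"
          using eventually_ge_at_top[of "- 2 * z"] by eventually_elim simp
      qed
      then have "((\<lambda>x::real. exp (- x / 2)) \<longlongrightarrow> 0) at_top"
        by (rule filterlim_compose[OF exp_at_bot])
      then show "((\<lambda>x. C * exp (- x / 2)) \<longlongrightarrow> 0) at_top"
        using tendsto_mult_right_zero by blast
    qed
    then show "((weight \<beta> t \<circ> real_of_ereal) \<longlongrightarrow> 0) (at_left \<infinity>)"
      by (simp add: ereal_tendsto_simps)
  qed simp
  then have "(LBINT x:{0<..}. ?f x) = 0"
    by (simp add: interval_lebesgue_integral_def ei)
  moreover have "(LBINT x:{0<..}. ?f x) =
      \<beta> * moment (\<beta> - 1) 1 t + t * moment (\<beta> - 2) 1 t - moment \<beta> 1 t"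
    using int unfolding moment_def
    by (subst set_integral_diff set_integral_add; (intro set_integral_add set_integrable_mult_right)?; simp)+
  ultimately show ?thesis by simp
qed

text \<open>In the induction, the extra \<open>p\<close> in the derivative of \<open>x * p\<close>
  compensates the shift from \<open>\<beta>\<close> to \<open>\<beta> + 1\<close>.\<close>

lemma moment_parts:
  assumes "t > 0"
  shows "moment \<beta> (pderiv p) t = moment \<beta> p t - \<beta> * moment (\<beta> - 1) p t - t * moment (\<beta> - 2) p t"
proof (induction p arbitrary: \<beta>)
  case 0
  then show ?case by simp
next
  case (pCons c p)
  have "c * (moment \<beta> 1 t - \<beta> * moment (\<beta> - 1) 1 t - t * moment (\<beta> - 2) 1 t) = 0"
    by (simp only: moment_1_parts[OF assms] mult_zero_right)
  then show ?case
    using pCons.IH[of "\<beta> + 1"]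
    by (simp add: pderiv_pCons moment_add[OF assms] moment_pCons_0 moment_pCons[OF assms, of _ c] ring_distribs mult_ac)
qed

section \<open>The Hankel determinant\<close>

text \<open>In the Leibniz expansion a permutation other than the identity moves at least two
  indices, so two factors vanish at \<open>t\<close> and it contributes nothing even to first
  order.\<close>

lemma det_derivative_at_diagonal:
  fixes e :: "nat \<Rightarrow> nat \<Rightarrow> real \<Rightarrow> real"
  assumes der: "\<And>i j. i < n \<Longrightarrow> j < n \<Longrightarrow> (e i j has_real_derivative e' i j) (at t)"
    and diag: "\<And>i j. i < n \<Longrightarrow> j < n \<Longrightarrow> i \<noteq> j \<Longrightarrow> e i j t = 0"
    and nz: "\<And>i. i < n \<Longrightarrow> e i i t \<noteq> 0"
  defines "D \<equiv> \<lambda>u. Determinant.det (Matrix.mat n n (\<lambda>(i, j). e i j u))"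
  shows "D t = (\<Prod>i<n. e i i t)"
    and "(D has_real_derivative (\<Prod>i<n. e i i t) * (\<Sum>i<n. e' i i / e i i t)) (at t)"
proof -
  let ?S = "{p. p permutes {0..<n}}"
  have less: "p i < n" if "p permutes {0..<n}" "i < n" for p i
    using permutes_in_image[OF that(1), of i] that(2) by simp
  have D: "D u = (\<Sum>p\<in>?S. signof p * (\<Prod>i<n. e i (p i) u))" for u
    unfolding D_def by (subst det_def'[of _ n])
      (auto intro!: sum.cong prod.cong simp: lessThan_atLeast0 less)
  define T where "T p = (if p = id then (\<Prod>i<n. e i i t) else 0)" for p :: "nat \<Rightarrow> nat"
  define T' where "T' p = (if p = id then (\<Prod>i<n. e i i t) * (\<Sum>i<n. e' i i / e i i t) else 0)"
    for p :: "nat \<Rightarrow> nat"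
  have fixed: "(\<Prod>i\<in>A. e i (p i) t) = 0"
    if p: "p permutes {0..<n}" and "finite A" "A \<subseteq> {..<n}" "k \<in> A" "p k \<noteq> k" for p A k
    using that diag[of k "p k"] less[OF p, of k] by (intro prod_zero) auto
  have term_value: "signof p * (\<Prod>i<n. e i (p i) t) = T p" if p: "p permutes {0..<n}" for p
  proof (cases "p = id")
    case False
    then obtain k where "p k \<noteq> k" by (auto simp: fun_eq_iff)
    moreover from this have "k < n"
      using p by (metis atLeastLessThan_iff permutes_not_in zero_le)
    ultimately show ?thesis
      using fixed[OF p, of "{..<n}" k] False by (simp add: T_def)
  qed (simp add: T_def)
  have term_deriv: "((\<lambda>u. signof p * (\<Prod>i<n. e i (p i) u)) has_real_derivative T' p) (at t)"
    if p: "p permutes {0..<n}" for p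
  proof -
    have "((\<lambda>u. signof p * (\<Prod>i<n. e i (p i) u)) has_real_derivative
        signof p * (\<Sum>i<n. e' i (p i) * (\<Prod>j\<in>{..<n} - {i}. e j (p j) t))) (at t)"
      using p by (intro DERIV_cmult has_field_derivative_prod der) (auto simp: less)
    also have "signof p * (\<Sum>i<n. e' i (p i) * (\<Prod>j\<in>{..<n} - {i}. e j (p j) t)) = T' p"
    proof (cases "p = id")
      case True
      have "(\<Prod>j\<in>{..<n} - {i}. e j j t) = (\<Prod>j<n. e j j t) / e i i t" if "i < n" for i
        using that nz[of i] by (subst prod.remove[of "{..<n}" i]) auto
      then show ?thesis
        using True by (simp add: T'_def sum_distrib_left mult.commute)
    next
      case False
      then obtain k where k: "p k \<noteq> k" by (auto simp: fun_eq_iff)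
      have others: "(\<Prod>j\<in>{..<n} - {i}. e j (p j) t) = 0" for i
      proof -
        \<comment> \<open>both \<open>k\<close> and \<open>p k\<close> are moved, and at most one of them is \<open>i\<close>\<close>
        have "p (p k) \<noteq> p k"
          using k permutes_inj[OF p] by (auto dest: injD)
        then obtain l where l: "p l \<noteq> l" "l \<noteq> i"
          using k by (cases "k = i") auto
        then have "l < n"
          using p by (metis atLeastLessThan_iff permutes_not_in zero_le)
        then show ?thesis
          using fixed[OF p, of "{..<n} - {i}" l] l by auto
      qed
      show ?thesis
        unfolding others using False by (simp add: T'_def)
    qed
    finally show ?thesis .
  qed
  have fin: "finite ?S" by (simp add: finite_permutations)
  have id: "id \<in> ?S" by (simp add: permutes_id)
  have "D t = (\<Sum>p\<in>?S. T p)"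
    unfolding D by (intro sum.cong) (simp_all add: term_value)
  also have "\<dots> = (\<Prod>i<n. e i i t)"
    unfolding T_def using fin id by simp
  finally show "D t = (\<Prod>i<n. e i i t)" .
  have "((\<lambda>u. \<Sum>p\<in>?S. signof p * (\<Prod>i<n. e i (p i) u)) has_real_derivative (\<Sum>p\<in>?S. T' p)) (at t)"
    by (intro DERIV_sum term_deriv) simp
  also have "(\<Sum>p\<in>?S. T' p) = (\<Prod>i<n. e i i t) * (\<Sum>i<n. e' i i / e i i t)"
    unfolding T'_def using fin id by simp
  finally show "(D has_real_derivative (\<Prod>i<n. e i i t) * (\<Sum>i<n. e' i i / e i i t)) (at t)"
    unfolding D[abs_def] .
qed

lemma hankel_D_eq_moment:
  "hankel_D \<alpha> n t = Determinant.det (Matrix.mat n n (\<lambda>(j, k). moment \<alpha> (monom 1 (j + k)) t))"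
  unfolding hankel_D_def moment_def weight_def by (simp add: poly_monom mult.assoc)

text \<open>The change of basis is a congruence by a unit lower triangular matrix. The polynomials
  are not tied to \<open>t\<close>, so one basis serves all nearby parameters.\<close>

lemma hankel_D_monic_basis:
  assumes "t > 0" and deg: "\<And>i. degree (P i) = i" and lead: "\<And>i. coeff (P i) i = 1"
  shows "hankel_D \<alpha> n t = Determinant.det (Matrix.mat n n (\<lambda>(i, j). moment \<alpha> (P i * P j) t))"
proof -
  define A where "A = Matrix.mat n n (\<lambda>(i, j). coeff (P i) j)"
  define M where "M = Matrix.mat n n (\<lambda>(j, k). moment \<alpha> (monom 1 (j + k)) t)"
  have carrier: "A \<in> carrier_mat n n" "M \<in> carrier_mat n n"
    by (simp_all add: A_def M_def)
  have expand: "P i = (\<Sum>k<n. monom (coeff (P i) k) k)" if "i < n" for i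
  proof (rule poly_eqI)
    fix m
    have "coeff (P i) m = 0" if "\<not> m < n"
      using \<open>i < n\<close> that deg[of i] by (intro coeff_eq_0) auto
    then show "coeff (P i) m = coeff (\<Sum>k<n. monom (coeff (P i) k) k) m"
      by (simp add: coeff_sum)
  qed
  have entry: "moment \<alpha> (P i * P j) t =
      (\<Sum>l<n. (\<Sum>k<n. coeff (P i) k * moment \<alpha> (monom 1 (k + l)) t) * coeff (P j) l)"
    if "i < n" "j < n" for i j
  proof -
    have monom: "moment \<alpha> (monom c m) t = c * moment \<alpha> (monom 1 m) t" for c m
      using moment_smult[of \<alpha> c "monom 1 m" t] by (simp add: smult_monom)
    have "P i * P j = (\<Sum>k<n. \<Sum>l<n. monom (coeff (P i) k * coeff (P j) l) (k + l))"
      by (subst expand[OF that(1)], subst expand[OF that(2)]) (simp add: sum_product mult_monom)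
    then have "moment \<alpha> (P i * P j) t =
        (\<Sum>k<n. \<Sum>l<n. coeff (P i) k * coeff (P j) l * moment \<alpha> (monom 1 (k + l)) t)"
      using assms(1) by (simp add: moment_sum monom[of "coeff (P i) _ * coeff (P j) _"])
    also have "\<dots> = (\<Sum>l<n. \<Sum>k<n. coeff (P i) k * coeff (P j) l * moment \<alpha> (monom 1 (k + l)) t)"
      by (rule sum.swap)
    finally show ?thesis
      unfolding sum_distrib_right by (simp only: mult_ac)
  qed
  have "Matrix.mat n n (\<lambda>(i, j). moment \<alpha> (P i * P j) t) = A * M * transpose_mat A"
    by (rule eq_matI)
      (auto simp: A_def M_def entry scalar_prod_def lessThan_atLeast0)
  moreover have "Determinant.det A = 1"
  proof -
    have "Determinant.det A = prod_list (diag_mat A)"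
      using carrier(1) deg by (intro det_lower_triangular[of n]) (auto simp: A_def coeff_eq_0)
    also have "\<dots> = 1"
      by (simp add: prod_list_diag_prod A_def lead)
    finally show ?thesis .
  qed
  ultimately show ?thesis
    using carrier by (simp add: hankel_D_eq_moment det_mult det_transpose flip: M_def)
qed

text \<open>The exponent \<open>\<alpha> - 2\<close> encodes the division by
  \<open>x\<^sup>2\<close> built into \<open>F\<close>.\<close>

lemma semiclassical_laguerre_moment:
  assumes "s > 0"
  shows "semiclassical_laguerre (\<lambda>p. moment (\<alpha> - 2) p s) \<alpha> s"
proof
  fix p :: "real poly"
  have shift: "\<alpha> - 2 + 1 = \<alpha> - 1" "\<alpha> - 1 + 1 = \<alpha>" by simp_all
  show "moment (\<alpha> - 2) (pCons 0 (pCons 0 (p * p))) s > 0" if "p \<noteq> 0"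
    unfolding moment_pCons_0 shift using assms that by (rule moment_square_pos)
  show "moment (\<alpha> - 2) (pCons 0 (pCons 0 (pderiv p))) s = moment (\<alpha> - 2) (pCons 0 (pCons 0 p)) s
      - \<alpha> * moment (\<alpha> - 2) (pCons 0 p) s - s * moment (\<alpha> - 2) p s"
    unfolding moment_pCons_0 shift using assms by (rule moment_parts)
qed (use assms in \<open>simp_all add: moment_add moment_smult\<close>)

lemma hankel_H_eq_sum:
  assumes "s > 0"
  shows "hankel_H \<alpha> m s = - (\<Sum>j<m. semiclassical_laguerre.a (\<lambda>p. moment (\<alpha> - 2) p s) s j)"
proof -
  interpret semiclassical_laguerre "\<lambda>p. moment (\<alpha> - 2) p s" \<alpha> s
    using assms by (rule semiclassical_laguerre_moment)
  have L0: "L0 p = moment \<alpha> p s" and L1: "L1 p = moment (\<alpha> - 1) p s" for p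
    by (simp_all add: moment_pCons_0)
  \<comment> \<open>\<open>P\<close> belongs to the fixed \<open>s\<close> and only the weight
    varies with \<open>u\<close>, so the matrix is diagonal at \<open>u = s\<close>.\<close>
  let ?E = "\<lambda>u. Determinant.det (Matrix.mat m m (\<lambda>(i, j). moment \<alpha> (P i * P j) u))"
  have h: "moment \<alpha> (P i * P i) s = h i" for i
    by (simp add: h_def L0)
  have orth: "moment \<alpha> (P i * P j) s = 0" if "i \<noteq> j" for i j
    using L0_P_P[OF that] by (simp add: L0)
  have nz: "moment \<alpha> (P i * P i) s \<noteq> 0" for i
    using h_pos[of i] by (simp add: h)
  note det = det_derivative_at_diagonal[of m "\<lambda>i j. moment \<alpha> (P i * P j)"
      "\<lambda>i j. - moment (\<alpha> - 1) (P i * P j) s" s, OF moment_derivative[OF assms] orth nz]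
  let ?p = "\<Prod>i<m. h i" and ?r = "\<Sum>i<m. - moment (\<alpha> - 1) (P i * P i) s / h i"
  have p: "?p > 0"
    by (intro prod_pos) (simp add: h_pos)
  have "\<forall>\<^sub>F u in nhds s. u > 0"
    using eventually_nhds_in_open[of "{0<..}" s] assms by simp
  then have "\<forall>\<^sub>F u in nhds s. hankel_D \<alpha> m u = ?E u"
    by eventually_elim (rule hankel_D_monic_basis; simp)
  moreover have "(?E has_real_derivative ?p * ?r) (at s)"
    using det(2) by (simp add: h)
  ultimately have deriv: "(hankel_D \<alpha> m has_real_derivative ?p * ?r) (at s)"
    using DERIV_cong_ev[of s s "hankel_D \<alpha> m" ?E] by simp
  have D: "hankel_D \<alpha> m s = ?p"
    using hankel_D_monic_basis[of s P \<alpha> m] assms det(1) by (simp add: h)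
  have "(ln has_real_derivative 1 / ?p) (at (hankel_D \<alpha> m s))"
    unfolding D using p by (rule DERIV_ln_divide)
  from DERIV_chain2[OF this deriv]
  have "((\<lambda>u. ln (hankel_D \<alpha> m u)) has_real_derivative 1 / ?p * (?p * ?r)) (at s)" .
  moreover have cancel: "1 / x * (x * y) = y" if "x > 0" for x y :: real
    using that by simp
  ultimately have "((\<lambda>u. ln (hankel_D \<alpha> m u)) has_real_derivative ?r) (at s)"
    by (simp only: cancel[OF p])
  then have "hankel_H \<alpha> m s = s * ?r"
    unfolding hankel_H_def by (simp add: DERIV_imp_deriv)
  then show ?thesis
    by (simp add: a_def L1 sum_negf sum_distrib_left)
qed

theorem theorem4:
  fixes \<alpha> s :: real and n :: nat
  assumes "\<alpha> > 0" and "s > 0" and "n \<ge> 1"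
  defines "H \<equiv> \<lambda>m. hankel_H \<alpha> m s"
    and "\<delta>2H \<equiv> delta2_H \<alpha> n s"
  shows "((H n - real n * (real n + \<alpha>)) * \<delta>2H + real n * s)
         * ((H n - real n * (real n + \<alpha>) - s) * \<delta>2H - (real n + \<alpha>) * s)
       = (2 * real n + \<alpha> + \<delta>2H)
         * (real n * s + (2 * real n + \<alpha>) * (real n * (real n + \<alpha>) - H n))
         * (H n - H (n + 1)) * (H (n - 1) - H n)"
proof -
  interpret semiclassical_laguerre "\<lambda>p. moment (\<alpha> - 2) p s" \<alpha> s
    using assms(2) by (rule semiclassical_laguerre_moment)
  have sum: "hankel_H \<alpha> m s = - (\<Sum>j<m. a j)" for m
    using assms(2) by (rule hankel_H_eq_sum)
  \<comment> \<open>\<open>sigma_identity\<close> is indexed by the predecessor of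
    \<open>n\<close>.\<close>
  obtain k where n: "n = Suc k"
    using assms(3) by (cases n) auto
  have H: "H n = - (\<Sum>j\<le>k. a j)" "H n - H (n + 1) = a (Suc k)" "H (n - 1) - H n = a k"
    and d: "\<delta>2H = a k + a (Suc k)"
    by (simp_all add: H_def \<delta>2H_def delta2_H_def sum n flip: lessThan_Suc_atMost)
  show ?thesis
    unfolding H(2,3) d unfolding H(1) unfolding n by (rule sigma_identity)
qed

end
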